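(* Let $(X,d)$ be an ultrametric space with at least two points. Then $(X,d)$ has a finite metric basis $S$ if and only if it is pseudo-complete and the set $P(X)\cup UP(X)$ is finite, where $P(X)$ is the set of partnered points and $UP(X)$ the set of unpartnered points. In this case, if $\mathfrak{P}(X)=\{[x_i] : 1\le i\le n\}$ is the set of (distinct) classes of partnered points under the relation of being partners, there is $(\alpha_1,\dots,\alpha_n)\in\prod_{i=1}^n[x_i]$ such that $S=\bigcup_{i=1}^n\big([x_i]\smallsetminus\{\alpha_i\}\big)\cup UP(X)$.
   Context: A metric space $(X,d)$ is ultrametric if $d(x,y)\le\max\{d(x,z),d(z,y)\}$ for all $x,y,z\in X$. Points $x,y\in X$ are distinguished by $z\in X$ if $d(x,z)\neq d(y,z)$. A set $S\subseteq X$ is a metric generator for $X$ if any pair of different points of $X$ is distinguished by at least one element of $S$. A metric basis is a metric generator of minimum cardinality in $X$. Write $B_r(x)=\{p\in X: d(x,p)<r\}$, with $B_\infty(x)=X$. Two different points $x,y\in X$ are partners if $d(x,z)\ge d(x,y)$ and $d(y,z)\ge d(x,y)$ for all $z\in X\smallsetminus\{x,y\}$. A point $x$ is partnered if there is $y\in X$ such that $x,y$ are partners. A point $x$ is pseudopartnered if it is not partnered but there is $y\in X$, $y\ne x$, with $d(x,z)\ge d(x,y)$ for all $z\in X\smallsetminus\{x,y\}$. A point is unpartnered if it is neither partnered nor pseudopartnered. Being partners (together with equality) is an equivalence relation $\sim$ on $P(X)$; $\mathfrak{P}(X)=P(X)/\sim$ and $[x]=\{z\in X: x,z\text{ are partners}\}\cup\{x\}$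 for $x\in P(X)$. Given a pseudopartnered point $x$, an $x$-pseudopartnering sequence $(x_n)_{n\ge 1}$ with associated distances $(d_n)_{n\ge1}$ is any sequence obtained inductively as follows: $x_1=x$, $d_1=\infty$. Given $x_n,d_n$: if $|B_{d_n}(x_n)|=1$ or $d_n=0$, put $x_{n+1}=x_n$, $d_{n+1}=0$. If $|B_{d_n}(x_n)|>1$, let $I_n=\{d(x_n,z): z\in B_{d_n}(x_n)\smallsetminus\{x_n\}\}$; if $I_n$ has no minimum put $x_{n+1}=x_n$, $d_{n+1}=0$; if $I_n$ has a minimum, choose any $x_{n+1}\in\{z\in X: d(x_n,z)=\min I_n\}$ and put $d_{n+1}=d(x_n,x_{n+1})$. A point $z\in X$ is a pseudolimit of a pseudopartnering sequence $(x_n)$ if $d(z,x_n)=d(x_n,x_{n+1})$ for every $n$. $(X,d)$ is pseudo-complete if for every pseudopartnered point $x\in X$: (i) every $x$-pseudopartnering sequence has a pseudolimit, and (ii) at least one $x$-pseudopartnering sequence has a finite number of pseudolimits. *)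

theory Defs
  imports "HOL-Analysis.Analysis"
begin

locale Ultrametric_space = Metric_space M d
  for M :: "'a set" and d :: "'a \<Rightarrow> 'a \<Rightarrow> real" +
  assumes ultrametric:
    "\<And>x y z. \<lbrakk>x \<in> M; y \<in> M; z \<in> M\<rbrakk> \<Longrightarrow> d x y \<le> max (d x z) (d z y)"

context Metric_space
begin

definition distinguished_by :: "'a \<Rightarrow> 'a \<Rightarrow> 'a \<Rightarrow> bool" where
  "distinguished_by x y z \<longleftrightarrow> d x z \<noteq> d y z"

definition metric_generator :: "'a set \<Rightarrow> bool" where
  "metric_generator S \<longleftrightarrow>
     S \<subseteq> M \<and> (\<forall>x\<in>M. \<forall>y\<in>M. x \<noteq> y \<longrightarrow> (\<exists>z\<in>S. distinguished_by x y z))"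

text \<open>Cardinalities are compared with \<^term>\<open>S \<lesssim> T\<close>, because \<^const>\<open>card\<close> is 0 on infinite sets.\<close>

definition metric_basis :: "'a set \<Rightarrow> bool" where
  "metric_basis S \<longleftrightarrow> metric_generator S \<and> (\<forall>T. metric_generator T \<longrightarrow> S \<lesssim> T)"

definition partners :: "'a \<Rightarrow> 'a \<Rightarrow> bool" where
  "partners x y \<longleftrightarrow> x \<in> M \<and> y \<in> M \<and> x \<noteq> y \<and>
     (\<forall>z\<in>M - {x, y}. d x z \<ge> d x y \<and> d y z \<ge> d x y)"

definition partnered :: "'a \<Rightarrow> bool" where
  "partnered x \<longleftrightarrow> x \<in> M \<and> (\<exists>y\<in>M. partners x y)"

definition pseudopartnered :: "'a \<Rightarrow> bool" where
  "pseudopartnered x \<longleftrightarrow> x \<in> M \<and> \<not> partnered x \<and>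
     (\<exists>y\<in>M. y \<noteq> x \<and> (\<forall>z\<in>M - {x, y}. d x z \<ge> d x y))"

definition unpartnered :: "'a \<Rightarrow> bool" where
  "unpartnered x \<longleftrightarrow> x \<in> M \<and> \<not> partnered x \<and> \<not> pseudopartnered x"

definition partnered_points :: "'a set" where
  "partnered_points = {x \<in> M. partnered x}"

definition unpartnered_points :: "'a set" where
  "unpartnered_points = {x \<in> M. unpartnered x}"

definition partner_class :: "'a \<Rightarrow> 'a set" where
  "partner_class x = {z \<in> M. partners x z} \<union> {x}"

definition partner_rel :: "('a \<times> 'a) set" where
  "partner_rel = {(x, y) \<in> partnered_points \<times> partnered_points. partners x y \<or> x = y}"

definition partner_classes :: "'a set set" where
  "partner_classes = partnered_points // partner_rel"

text \<open>The open ball with a possibly infinite radius; it is all of \<^term>\<open>M\<close> for radius \<^term>\<open>\<infinity>\<close>.\<close>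

definition ext_mball :: "'a \<Rightarrow> ereal \<Rightarrow> 'a set" where
  "ext_mball x r = {p \<in> M. ereal (d x p) < r}"

definition ball_distances :: "'a \<Rightarrow> ereal \<Rightarrow> real set" where
  "ball_distances x r = (\<lambda>z. d x z) ` (ext_mball x r - {x})"

text \<open>
  One step from $(x_n, d_n) = (x, r)$ to $(x_{n+1}, d_{n+1}) = (x', r')$. For \<^term>\<open>x \<in> M\<close> and
  \<^term>\<open>r > 0\<close> the ball contains \<^term>\<open>x\<close>, so where its \<^const>\<open>card\<close> is not 1 it has
  more than one point (it may be infinite).
\<close>

definition pseudopartnering_step :: "'a \<Rightarrow> ereal \<Rightarrow> 'a \<Rightarrow> ereal \<Rightarrow> bool" where
  "pseudopartnering_step x r x' r' \<longleftrightarrow>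
     (if card (ext_mball x r) = 1 \<or> r = 0 then x' = x \<and> r' = 0
      else let I = ball_distances x r in
        if \<exists>m\<in>I. \<forall>t\<in>I. m \<le> t
        then x' \<in> {z \<in> M. d x z = (LEAST t. t \<in> I)} \<and> r' = ereal (d x x')
        else x' = x \<and> r' = 0)"

text \<open>Sequences are indexed from 0, so that \<^term>\<open>xs 0\<close> and \<^term>\<open>ds 0\<close> are $x_1$ and $d_1$.\<close>

definition pseudopartnering_seq :: "'a \<Rightarrow> (nat \<Rightarrow> 'a) \<Rightarrow> bool" where
  "pseudopartnering_seq x xs \<longleftrightarrow>
     (\<exists>ds :: nat \<Rightarrow> ereal. xs 0 = x \<and> ds 0 = \<infinity> \<and>
        (\<forall>n. pseudopartnering_step (xs n) (ds n) (xs (Suc n)) (ds (Suc n))))"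

definition pseudolimit :: "(nat \<Rightarrow> 'a) \<Rightarrow> 'a \<Rightarrow> bool" where
  "pseudolimit xs z \<longleftrightarrow> z \<in> M \<and> (\<forall>n. d z (xs n) = d (xs n) (xs (Suc n)))"

definition pseudo_complete :: bool where
  "pseudo_complete \<longleftrightarrow>
     (\<forall>x\<in>M. pseudopartnered x \<longrightarrow>
        (\<forall>xs. pseudopartnering_seq x xs \<longrightarrow> (\<exists>z. pseudolimit xs z)) \<and>
        (\<exists>xs. pseudopartnering_seq x xs \<and> finite {z. pseudolimit xs z}))"

end

end

theory Submission
  imports Defs
begin

text \<open>
  Call $y$ a nearest point of $x$ if it minimises $d(x,\cdot)$ on $X \setminus \{x\}$. Partners
  are mutually nearest points, and unpartnered points are the points that have no nearest point.

  No other point separates two partners, so a generator misses at most one point of each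
  partner class. A finite generator also contains every unpartnered point, since such a point
  has other points closer to it than any given finite set of other points, and these look the same
  from that set. The theorem says that for finite sets these two necessary conditions are
  sufficient as soon as the space is pseudo-complete.

  Sufficiency rests on the condition \<open>pseudo_anchored\<close>: the closed ball around a pseudopartnered
  point $x$ that just reaches the nearest points of $x$ contains a point that is not
  pseudopartnered. Suppose it holds, and let $d(x,y) = r > 0$. A point separates $x$ from $y$ once
  it lies in one of the open balls of radius $r$ around them. If both balls are
  singletons, $x$ and $y$ are partners, and one of them was chosen. Otherwise one of the balls
  contains an unpartnered point or a whole pair of partners, hence a chosen point
  (\<open>anchored_generator\<close>). In particular the partnered and the unpartnered points together generate.
  And a finite basis contains all unpartnered points and all but one point of every class; these
  already generate, so by minimality the basis has no further points.

  The condition holds in both situations of interest. If it fails for $x$, everything in the closed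
  ball is pseudopartnered. From any point $s$ of a generator in the ball one moves to a nearest
  point $w$ of $s$; the corresponding closed ball around $w$ lies in the first one, avoids $s$, and
  is again bad, so a finite generator would lose points forever
  (\<open>finite_generator_imp_anchored\<close>). If instead the space is pseudo-complete, the pseudopartnering
  sequences from $x$ never stop, as they would stop at a partnered or unpartnered point. Their
  pseudolimits are closed under passing to a nearest point, and when they are finitely many, a
  closest such pair is a pair of partners, a contradiction (\<open>pseudo_complete_imp_anchored\<close>).

  Conversely a finite generator yields pseudo-completeness. For a sequence that never stops, each
  consecutive pair of terms must be separated, and by the pigeonhole principle one point of the
  generator does so infinitely often; it is a pseudolimit (\<open>finite_generator_pseudolimit\<close>). And the
  condition above lets one steer a sequence to a point that is not pseudopartnered, where it stops
  and has a single pseudolimit (\<open>anchored_finite_pseudolimits\<close>).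
\<close>

section \<open>Nearest points and partners\<close>

context Ultrametric_space
begin

definition nearest :: "'a \<Rightarrow> 'a \<Rightarrow> bool" where
  "nearest x y \<longleftrightarrow> x \<in> M \<and> y \<in> M \<and> y \<noteq> x \<and> (\<forall>z\<in>M. z \<noteq> x \<longrightarrow> d x y \<le> d x z)"

lemma isosceles:
  assumes "x \<in> M" "y \<in> M" "z \<in> M" "d x y < d x z"
  shows "d y z = d x z"
  using ultrametric[of x z y] ultrametric[of y z x] assms commute[of x y] by (auto simp: max_def split: if_splits)

lemma partners_iff_nearest: "partners x y \<longleftrightarrow> nearest x y \<and> nearest y x"
proof
  assume p: "partners x y"
  have "d x y \<le> d x z" if "z \<in> M" "z \<noteq> x" for z
    using p that unfolding partners_def by (cases "z = y") auto
  moreover have "d y x \<le> d y z" if "z \<in> M" "z \<noteq> y" for z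
    using p that commute[of y x] unfolding partners_def by (cases "z = x") auto
  ultimately show "nearest x y \<and> nearest y x"
    using p unfolding partners_def nearest_def by blast
next
  assume "nearest x y \<and> nearest y x"
  then show "partners x y"
    unfolding partners_def nearest_def commute[of y x] by blast
qed

lemma partnered_iff: "partnered x \<longleftrightarrow> (\<exists>y. partners x y)"
  unfolding partnered_def partners_def by auto

lemma pseudopartnered_iff:
  "pseudopartnered x \<longleftrightarrow> x \<in> M \<and> \<not> partnered x \<and> (\<exists>y. nearest x y)"
  unfolding pseudopartnered_def nearest_def by force

lemma unpartnered_iff: "unpartnered x \<longleftrightarrow> x \<in> M \<and> \<not> (\<exists>y. nearest x y)"
  unfolding unpartnered_def pseudopartnered_iff partnered_iff partners_iff_nearest by auto

lemma partners_sym: "partners x y \<Longrightarrow> partners y x"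
  by (auto simp: partners_iff_nearest)

lemma nearest_dist_eq: "nearest x y \<Longrightarrow> nearest x z \<Longrightarrow> d x y = d x z"
  unfolding nearest_def by (meson order_antisym)

lemma nearest_pos: "nearest x y \<Longrightarrow> 0 < d x y"
  unfolding nearest_def by auto

lemma nearest_if_le: "nearest x y \<Longrightarrow> z \<in> M \<Longrightarrow> z \<noteq> x \<Longrightarrow> d x z \<le> d x y \<Longrightarrow> nearest x z"
  unfolding nearest_def by (meson order_trans)

text \<open>
  Distances from the common partner $y$ to $x$ and to $z$ are both the distance from $y$ to its
  nearest points, so $x$ and $z$ are at most that far apart, which is also how far their own
  nearest points are.
\<close>

lemma partners_trans:
  assumes "partners x y" "partners y z" "x \<noteq> z"
  shows "partners x z"
proof -
  have xy: "nearest x y" "nearest y x" and yz: "nearest y z" "nearest z y"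
    using assms by (auto simp: partners_iff_nearest)
  have M: "x \<in> M" "y \<in> M" "z \<in> M" using xy yz by (auto simp: nearest_def)
  have eq: "d y x = d y z" using xy yz nearest_dist_eq by blast
  have "d x z \<le> d y z" using ultrametric[of x z y] M eq commute[of x y] by auto
  then show ?thesis
    using nearest_if_le[OF xy(1), of z] nearest_if_le[OF yz(2), of x] assms(3) M eq
      commute[of x y] commute[of x z] commute[of y z]
    by (auto simp: partners_iff_nearest)
qed

text \<open>
  Passing from a point to a nearest point strictly decreases the distance to the nearest points,
  unless the two are partners.
\<close>

lemma partners_if_beyond:
  assumes "nearest x y" "nearest y z" "d x y \<le> d y z"
  shows "partners x y"
  using assms nearest_if_le[of y z x] commute[of x y]
  by (auto simp: partners_iff_nearest nearest_def)

section \<open>Points that a generator must contain\<close>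

lemma generator_separates:
  assumes "metric_generator S" "x \<in> M" "y \<in> M" "x \<noteq> y"
  obtains s where "s \<in> S" "s \<in> M" "d x s \<noteq> d y s"
  using assms unfolding metric_generator_def distinguished_by_def by blast

text \<open>
  Seen from any third point $s$, partners $x$ and $y$ are at the same distance, because $s$ is at
  least $d(x,y)$ away from each of them.
\<close>

lemma generator_meets_partners:
  assumes "metric_generator S" "partners x y"
  shows "x \<in> S \<or> y \<in> S"
proof (rule ccontr)
  assume no: "\<not> ?thesis"
  have xy: "nearest x y" "nearest y x" using assms by (auto simp: partners_iff_nearest)
  then have M: "x \<in> M" "y \<in> M" "x \<noteq> y" by (auto simp: nearest_def)
  then obtain s where s: "s \<in> S" "d x s \<noteq> d y s" and sM: "s \<in> M"
    using generator_separates[OF assms(1)] by metis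
  have "d x y \<le> d x s" "d x y \<le> d y s"
    using xy s no sM commute[of x y] unfolding nearest_def by metis+
  then show False
    using isosceles[of x y s] isosceles[of y x s] M sM s commute[of x y] by linarith
qed

text \<open>
  If $x$ is missing from $S$, some $w \neq x$ is closer to $x$ than all of the finite set $S$, and
  then every point of $S$ has the same distance to $w$ as to $x$. The second point $y$ keeps the
  set over which the minimal distance is taken nonempty.
\<close>

lemma finite_generator_contains_unpartnered:
  assumes S: "metric_generator S" "finite S" and x: "unpartnered x" and y: "y \<in> M" "y \<noteq> x"
  shows "x \<in> S"
proof (rule ccontr)
  assume no: "x \<notin> S"
  have xM: "x \<in> M" and far: "\<And>u. u \<in> M \<Longrightarrow> u \<noteq> x \<Longrightarrow> \<exists>z\<in>M. z \<noteq> x \<and> d x z < d x u"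
    using x unfolding unpartnered_iff nearest_def by force+
  have SM: "S \<subseteq> M" using S by (simp add: metric_generator_def)
  let ?U = "insert y S"
  obtain u where u: "u \<in> ?U" "\<And>v. v \<in> ?U \<Longrightarrow> d x u \<le> d x v"
    using arg_min_if_finite[of ?U "d x"] S(2) by (metis finite.insertI insert_not_empty not_le)
  have "u \<in> M" "u \<noteq> x" using u(1) no y SM by auto
  then obtain w where w: "w \<in> M" "w \<noteq> x" "d x w < d x u" using far by blast
  obtain s where s: "s \<in> S" "d x s \<noteq> d w s"
    using generator_separates[OF S(1) xM w(1)] w(2) by metis
  have "d x w < d x s" using w u(2)[of s] s by auto
  then show False using isosceles[of x w s] xM w s SM by auto
qed

text \<open>
  A generator misses at most one point of each partner class, so sending a missed point to one of
  its partners is an injection into the generator.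
\<close>

lemma finite_partnered_points:
  assumes S: "metric_generator S" "finite S"
  shows "finite partnered_points"
proof -
  have "\<exists>q. partners p q \<and> q \<in> S" if "p \<in> partnered_points - S" for p
    using that generator_meets_partners[OF S(1)] unfolding partnered_points_def partnered_iff by blast
  then obtain f where f: "\<And>p. p \<in> partnered_points - S \<Longrightarrow> partners p (f p) \<and> f p \<in> S"
    by metis
  have "inj_on f (partnered_points - S)"
  proof (rule inj_onI, rule ccontr)
    fix p q assume pq: "p \<in> partnered_points - S" "q \<in> partnered_points - S" "f p = f q" "p \<noteq> q"
    then have "partners p q" using f partners_trans partners_sym by metis
    then show False using generator_meets_partners[OF S(1)] pq by blast
  qed
  moreover have "f ` (partnered_points - S) \<subseteq> S" using f by blast
  ultimately have "finite (partnered_points - S)" using S(2) inj_on_finite by blast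
  then show ?thesis using S(2) by (simp add: finite_Diff2)
qed

section \<open>Anchored pseudopartnered points\<close>

text \<open>
  As $y$ is a nearest point of $x$, the closed ball of radius $d(x,y)$ is the smallest ball around
  $x$ with a second point.
\<close>

definition pseudo_anchored :: bool where
  "pseudo_anchored \<longleftrightarrow> (\<forall>x y. pseudopartnered x \<longrightarrow> nearest x y \<longrightarrow>
     (\<exists>p\<in>M. d x p \<le> d x y \<and> \<not> pseudopartnered p))"

text \<open>
  Descent on the number of points of $S$ in a closed ball around $x$, of radius the nearest
  distance, that has only pseudopartnered points. A point $s$ of $S$ in the ball exists, because it
  has to separate $x$ from $y$; for a nearest point $w$ of $s$, the ball around $w$ is smaller and
  excludes $s$.
\<close>

lemma finite_generator_imp_anchored:
  assumes S: "metric_generator S" "finite S"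
  shows pseudo_anchored
proof -
  have SM: "S \<subseteq> M" using S by (simp add: metric_generator_def)
  have "\<exists>p\<in>M. d x p \<le> d x y \<and> \<not> pseudopartnered p"
    if "pseudopartnered x" "nearest x y" for x y
    using that
  proof (induction "card {s\<in>S. d x s \<le> d x y}" arbitrary: x y rule: less_induct)
    case less
    show ?case
    proof (rule ccontr)
      assume "\<not> ?thesis"
      then have all: "\<And>p. p \<in> M \<Longrightarrow> d x p \<le> d x y \<Longrightarrow> pseudopartnered p" by blast
      have M: "x \<in> M" "y \<in> M" "x \<noteq> y" using less.prems by (auto simp: nearest_def)
      obtain s where s: "s \<in> S" "d x s \<noteq> d y s" and sM: "s \<in> M"
        using generator_separates[OF S(1) M] by metis
      have xs: "d x s \<le> d x y" using isosceles[of x y s] M sM s by force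
      have ps: "pseudopartnered s" using all sM xs by blast
      then obtain w where w: "nearest s w" unfolding pseudopartnered_iff by blast
      have wM: "w \<in> M" "w \<noteq> s" using w by (auto simp: nearest_def)
      have sw: "d s w \<le> d x y"
      proof (cases "s = x")
        case True
        then show ?thesis using w M by (simp add: nearest_def)
      next
        case False
        then show ?thesis using w M xs commute[of s x] unfolding nearest_def by force
      qed
      have xw: "d x w \<le> d x y" using ultrametric[of x w s] M wM sM xs sw by auto
      have pw: "pseudopartnered w" using all wM xw by blast
      then obtain v where v: "nearest w v" unfolding pseudopartnered_iff by blast
      have wv: "d w v < d s w"
        using partners_if_beyond[OF w v] ps unfolding pseudopartnered_iff partnered_iff by force
      have inside: "d x t \<le> d x y" if "t \<in> M" "d w t \<le> d w v" for t
        using ultrametric[of x t w] that M wM xw wv sw by auto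
      have "{t\<in>S. d w t \<le> d w v} \<subset> {t\<in>S. d x t \<le> d x y}"
      proof
        show "{t\<in>S. d w t \<le> d w v} \<subseteq> {t\<in>S. d x t \<le> d x y}" using inside SM by auto
        show "{t\<in>S. d w t \<le> d w v} \<noteq> {t\<in>S. d x t \<le> d x y}"
          using s xs wv commute[of s w] by force
      qed
      then have "card {t\<in>S. d w t \<le> d w v} < card {t\<in>S. d x t \<le> d x y}"
        using S(2) by (intro psubset_card_mono) auto
      from less.hyps[OF this pw v] show False using all inside by blast
    qed
  qed
  then show ?thesis unfolding pseudo_anchored_def by blast
qed

text \<open>
  The fact \<open>meets\<close> says that every open ball with at least two points meets $T$. So if two points
  are not separated by $T$, the open balls around them with their distance as radius are singletons,
  and the two points are partners.
\<close>

lemma anchored_generator: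
  assumes K: pseudo_anchored and T: "T \<subseteq> M" "unpartnered_points \<subseteq> T"
    and hit: "\<And>x y. partners x y \<Longrightarrow> x \<in> T \<or> y \<in> T"
  shows "metric_generator T"
proof -
  have meets: "\<exists>t\<in>T. d x t < r" if xM: "x \<in> M" and z: "z \<in> M" "z \<noteq> x" "d x z < r" for x z r
  proof -
    have "\<exists>p\<in>M. d x p < r \<and> \<not> pseudopartnered p"
    proof (cases "pseudopartnered x")
      case True
      then obtain y where y: "nearest x y" unfolding pseudopartnered_iff by blast
      have "d x y < r" using y z unfolding nearest_def by force
      then show ?thesis using K True y unfolding pseudo_anchored_def by (meson le_less_trans)
    next
      case False
      then show ?thesis using xM le_less_trans[OF nonneg z(3)] by (intro bexI[of _ x]) auto
    qed
    then obtain p where p: "p \<in> M" "d x p < r" "\<not> pseudopartnered p" by blast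
    show ?thesis
    proof (cases "unpartnered p")
      case True
      then show ?thesis using p T by (auto simp: unpartnered_points_def)
    next
      case False
      then obtain q where q: "partners p q"
        using p unfolding unpartnered_def partnered_iff by blast
      have pq: "nearest p q" using q by (simp add: partners_iff_nearest)
      have qM: "q \<in> M" using q by (simp add: partners_def)
      have "d p q < r"
      proof (cases "p = x")
        case True
        then show ?thesis using pq z unfolding nearest_def by force
      next
        case False
        then show ?thesis using pq xM p commute[of p x] unfolding nearest_def by force
      qed
      then have "d x q < r" using ultrametric[of x q p] xM qM p by auto
      then show ?thesis using hit[OF q] p by auto
    qed
  qed
  have "\<exists>t\<in>T. d x t \<noteq> d y t" if M: "x \<in> M" "y \<in> M" "x \<noteq> y" for x y
  proof (rule ccontr)
    assume "\<not> ?thesis"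
    then have eq: "\<And>t. t \<in> T \<Longrightarrow> d x t = d y t" by blast
    have far: "\<not> d x t < d x y" if "t \<in> T" for t
      using ultrametric[of x y t] eq[OF that] that T M commute[of t y] by auto
    have "nearest x y"
      using meets[of x _ "d x y"] far M unfolding nearest_def by (metis not_le)
    moreover have "nearest y x"
      using meets[of y _ "d x y"] far M eq commute[of x y] unfolding nearest_def by (metis not_le)
    ultimately have "x \<in> T \<or> y \<in> T" using hit by (simp add: partners_iff_nearest)
    then show False using eq[of x] eq[of y] M commute[of x y] by auto
  qed
  then show ?thesis using T unfolding metric_generator_def distinguished_by_def by blast
qed

section \<open>Pseudopartnering sequences\<close>

text \<open>
  If the distances within the ball have a minimum, it is the minimal distance to $x$ in the whole
  space, since points outside the ball are further away. So a step goes to a nearest point, or it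
  stops if there is none inside the ball.
\<close>

lemma pseudopartnering_step_iff:
  assumes x: "x \<in> M" and r: "0 \<le> r"
  shows "pseudopartnering_step x r x' r' \<longleftrightarrow>
    (if \<exists>y. nearest x y \<and> ereal (d x y) < r then nearest x x' \<and> r' = ereal (d x x')
     else x' = x \<and> r' = 0)"
proof (cases "r = 0")
  case True
  have "\<not> (\<exists>y. nearest x y \<and> ereal (d x y) < r)" using True by (simp add: not_less)
  then show ?thesis using True by (subst if_not_P) (auto simp: pseudopartnering_step_def)
next
  case False
  then have "0 < r" using r by auto
  then have xb: "x \<in> ext_mball x r" using x by (simp add: ext_mball_def zero_ereal_def)
  let ?I = "ball_distances x r"
  have Imem: "t \<in> ?I \<longleftrightarrow> (\<exists>z\<in>M. z \<noteq> x \<and> ereal (d x z) < r \<and> t = d x z)" for t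
    by (auto simp: ball_distances_def ext_mball_def)
  have min_iff: "(\<exists>m\<in>?I. \<forall>t\<in>?I. m \<le> t) \<longleftrightarrow> (\<exists>y. nearest x y \<and> ereal (d x y) < r)"
    (is "?A \<longleftrightarrow> ?B")
  proof
    assume ?A
    then obtain y where y: "y \<in> M" "y \<noteq> x" "ereal (d x y) < r"
      and least: "\<And>z. z \<in> M \<Longrightarrow> z \<noteq> x \<Longrightarrow> ereal (d x z) < r \<Longrightarrow> d x y \<le> d x z"
      unfolding Bex_def Ball_def Imem by blast
    have "d x y \<le> d x z" if "z \<in> M" "z \<noteq> x" for z
    proof (cases "ereal (d x z) < r")
      case True
      then show ?thesis using least that by blast
    next
      case False
      then have "ereal (d x y) < ereal (d x z)" using y(3) by (meson less_le_trans not_less)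
      then show ?thesis by simp
    qed
    then show ?B using x y unfolding nearest_def by blast
  next
    assume ?B
    then obtain y where y: "nearest x y" "ereal (d x y) < r" by blast
    show ?A
      by (rule bexI[of _ "d x y"]) (use y in \<open>auto simp: Imem nearest_def\<close>)
  qed
  have single: "\<not> (\<exists>m\<in>?I. \<forall>t\<in>?I. m \<le> t)" if "card (ext_mball x r) = 1"
  proof -
    have "ext_mball x r = {x}" using that xb by (metis card_1_singletonE singletonD)
    then show ?thesis by (auto simp: ball_distances_def)
  qed
  have least: "z \<in> M \<and> d x z = (LEAST t. t \<in> ?I) \<longleftrightarrow> nearest x z"
    if y: "nearest x y" "ereal (d x y) < r" for y z
  proof -
    have "(LEAST t. t \<in> ?I) = d x y"
      by (rule Least_equality) (use y in \<open>auto simp: Imem nearest_def\<close>)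
    moreover have "z \<in> M \<and> d x z = d x y \<longleftrightarrow> nearest x z"
    proof
      assume z: "z \<in> M \<and> d x z = d x y"
      then have "z \<noteq> x" using nearest_pos[OF y(1)] x by auto
      then show "nearest x z" using nearest_if_le[OF y(1)] z by simp
    next
      assume z: "nearest x z"
      then show "z \<in> M \<and> d x z = d x y"
        using nearest_dist_eq[OF y(1) z] by (simp add: nearest_def)
    qed
    ultimately show ?thesis by simp
  qed
  show ?thesis
    unfolding pseudopartnering_step_def Let_def
    using single False min_iff least by (auto split: if_splits)
qed

text \<open>
  The associated distances are $d_{n+1} = d(x_n, x_{n+1})$ for every $n$, even after the sequence has
  stopped, so the sequence can be described without them.
\<close>

lemma pseudopartnering_seqD:
  assumes x: "x \<in> M" and seq: "pseudopartnering_seq x xs"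
  shows pseudopartnering_seq_0: "xs 0 = x"
    and pseudopartnering_seq_in: "xs n \<in> M"
    and pseudopartnering_seq_nearest:
      "xs (Suc n) \<noteq> xs n \<Longrightarrow> nearest (xs n) (xs (Suc n))"
    and pseudopartnering_seq_start: "nearest x y \<Longrightarrow> xs 1 \<noteq> x"
    and pseudopartnering_seq_cont:
      "nearest (xs (Suc n)) y \<Longrightarrow> d (xs (Suc n)) y < d (xs n) (xs (Suc n)) \<Longrightarrow>
         xs (Suc (Suc n)) \<noteq> xs (Suc n)"
    and pseudopartnering_seq_decreasing:
      "xs (Suc (Suc n)) \<noteq> xs (Suc n) \<Longrightarrow>
         d (xs (Suc n)) (xs (Suc (Suc n))) < d (xs n) (xs (Suc n))"
proof -
  obtain ds where ds: "xs 0 = x" "ds 0 = \<infinity>"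
    "\<And>n. pseudopartnering_step (xs n) (ds n) (xs (Suc n)) (ds (Suc n))"
    using seq unfolding pseudopartnering_seq_def by blast
  have inv: "xs n \<in> M \<and> 0 \<le> ds n" for n
  proof (induction n)
    case 0
    then show ?case using ds x by simp
  next
    case (Suc n)
    then show ?case
      using ds(3)[of n] by (auto simp: pseudopartnering_step_iff nearest_def split: if_splits)
  qed
  have step: "if \<exists>y. nearest (xs n) y \<and> ereal (d (xs n) y) < ds n
      then nearest (xs n) (xs (Suc n)) \<and> ds (Suc n) = ereal (d (xs n) (xs (Suc n)))
      else xs (Suc n) = xs n \<and> ds (Suc n) = 0" for n
    using pseudopartnering_step_iff inv ds(3) by blast
  have dist: "ds (Suc n) = ereal (d (xs n) (xs (Suc n)))" for n
    using step[of n] inv[of n] by (auto simp: zero_ereal_def split: if_splits)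
  show "xs 0 = x" by (fact ds)
  show "xs n \<in> M" using inv by blast
  show "nearest (xs n) (xs (Suc n))" if "xs (Suc n) \<noteq> xs n"
    using step[of n] that by (auto split: if_splits)
  show "xs 1 \<noteq> x" if "nearest x y"
    using step[of 0] that ds by (auto split: if_splits simp: nearest_def)
  show "xs (Suc (Suc n)) \<noteq> xs (Suc n)"
    if "nearest (xs (Suc n)) y" "d (xs (Suc n)) y < d (xs n) (xs (Suc n))"
    using step[of "Suc n"] that dist[of n] by (auto split: if_splits simp: nearest_def)
  show "d (xs (Suc n)) (xs (Suc (Suc n))) < d (xs n) (xs (Suc n))"
    if "xs (Suc (Suc n)) \<noteq> xs (Suc n)"
    using step[of "Suc n"] that dist[of n] nearest_dist_eq
    by (metis less_ereal.simps(1))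
qed

text \<open>
  Every later step is shorter than $d(x_m, x_{m+1})$, so in an ultrametric space the whole tail
  stays within that distance of $x_{m+1}$.
\<close>

lemma pseudopartnering_seq_tail:
  assumes x: "x \<in> M" and seq: "pseudopartnering_seq x xs" and ne: "xs (Suc m) \<noteq> xs m"
    and "m < n"
  shows "d (xs (Suc m)) (xs n) < d (xs m) (xs (Suc m))"
    and "d (xs m) (xs n) = d (xs m) (xs (Suc m))"
proof -
  note D = pseudopartnering_seqD[OF x seq]
  have pos: "0 < d (xs m) (xs (Suc m))" using nearest_pos D(3) ne by blast
  have step: "d (xs (Suc m + k)) (xs (Suc (Suc m + k))) < d (xs m) (xs (Suc m))" for k
  proof (induction k)
    case 0
    then show ?case using D(6)[of m] pos D(2) by (cases "xs (Suc (Suc m)) = xs (Suc m)") auto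
  next
    case (Suc k)
    then show ?case using D(6)[of "Suc m + k"] pos D(2)
      by (cases "xs (Suc (Suc m + Suc k)) = xs (Suc m + Suc k)") auto
  qed
  have tail: "d (xs (Suc m)) (xs (Suc m + k)) < d (xs m) (xs (Suc m))" for k
  proof (induction k)
    case 0
    then show ?case using pos D(2) by simp
  next
    case (Suc k)
    then show ?case
      using ultrametric[OF D(2) D(2) D(2), of "Suc m" "Suc m + Suc k" "Suc m + k"] step[of k]
      by auto
  qed
  show lt: "d (xs (Suc m)) (xs n) < d (xs m) (xs (Suc m))"
    using tail[of "n - Suc m"] \<open>m < n\<close> by simp
  show "d (xs m) (xs n) = d (xs m) (xs (Suc m))"
    using isosceles[OF D(2) D(2) D(2), of "Suc m" n m] lt commute by metis
qed

text \<open>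
  The pseudolimit is the point at which the sequence stops.
\<close>

lemma pseudolimit_of_stopping:
  assumes x: "x \<in> M" and seq: "pseudopartnering_seq x xs" and stop: "xs (Suc n) = xs n"
  shows "\<exists>z. pseudolimit xs z"
proof -
  note D = pseudopartnering_seqD[OF x seq]
  define N where "N = (LEAST n. xs (Suc n) = xs n)"
  have N: "xs (Suc N) = xs N" unfolding N_def using stop by (rule LeastI)
  have before: "xs (Suc m) \<noteq> xs m" if "m < N" for m
    using that not_less_Least unfolding N_def by blast
  have eq: "xs (N + k) = xs N \<and> xs (Suc (N + k)) = xs N" for k
  proof (induction k)
    case 0
    then show ?case using N by simp
  next
    case (Suc k)
    have "xs (Suc (Suc (N + k))) = xs (Suc (N + k))"
      using D(6)[of "N + k"] Suc nonneg[of "xs N" "xs (Suc (Suc (N + k)))"] D(2)[of N]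
      by (metis not_less mdist_zero)
    then show ?case using Suc by simp
  qed
  have "d (xs N) (xs m) = d (xs m) (xs (Suc m))" for m
  proof (cases "m < N")
    case True
    then show ?thesis using pseudopartnering_seq_tail(2)[OF x seq before] commute by metis
  next
    case False
    then show ?thesis using eq[of "m - N"] by simp
  qed
  then show ?thesis using D(2) unfolding pseudolimit_def by blast
qed

lemma pseudolimit_if_in_balls:
  assumes x: "x \<in> M" and seq: "pseudopartnering_seq x xs" and z: "z \<in> M"
    and close: "\<And>n. d z (xs (Suc n)) < d (xs n) (xs (Suc n))"
  shows "pseudolimit xs z"
proof -
  note D = pseudopartnering_seqD[OF x seq]
  have "d z (xs n) = d (xs n) (xs (Suc n))" for n
    using isosceles[OF D(2) z D(2), of "Suc n" n] close[of n] commute by metis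
  then show ?thesis using z unfolding pseudolimit_def by blast
qed

text \<open>
  As $x_{n+1}$ is nearest to $x_n$, a point that separates them is $x_n$ itself or is closer to
  $x_{n+1}$ than $x_n$ is. One point $s$ of the finite set does this for infinitely many $n$. Being
  a term of the sequence at most once, it lies in arbitrarily late balls, and these are nested.
\<close>

lemma finite_generator_pseudolimit:
  assumes S: "metric_generator S" "finite S" and x: "x \<in> M" and seq: "pseudopartnering_seq x xs"
  shows "\<exists>z. pseudolimit xs z"
proof (cases "\<exists>n. xs (Suc n) = xs n")
  case True
  then show ?thesis using pseudolimit_of_stopping[OF x seq] by blast
next
  case False
  then have ne: "\<And>n. xs (Suc n) \<noteq> xs n" by blast
  note D = pseudopartnering_seqD[OF x seq]
  have SM: "S \<subseteq> M" using S by (simp add: metric_generator_def)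
  have "\<exists>s\<in>S. s = xs n \<or> d s (xs (Suc n)) < d (xs n) (xs (Suc n))" for n
  proof -
    obtain s where s: "s \<in> S" "d (xs n) s \<noteq> d (xs (Suc n)) s"
      using generator_separates[OF S(1) D(2) D(2)] ne by metis
    have near: "nearest (xs n) (xs (Suc n))" using D(3) ne by blast
    have "d s (xs (Suc n)) < d (xs n) (xs (Suc n))" if "s \<noteq> xs n"
    proof (rule ccontr)
      assume "\<not> ?thesis"
      then have a: "d (xs n) (xs (Suc n)) \<le> d (xs (Suc n)) s" using commute by simp
      have b: "d (xs n) (xs (Suc n)) \<le> d (xs n) s"
        using near that s SM unfolding nearest_def by blast
      have sM: "s \<in> M" using s SM by auto
      show False using a b s isosceles[OF D(2) D(2) sM, of n "Suc n"]
          isosceles[OF D(2) D(2) sM, of "Suc n" n] commute[of "xs n" "xs (Suc n)"] by linarith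
    qed
    then show ?thesis using s by blast
  qed
  then obtain f where f: "\<And>n. f n \<in> S" 
    "\<And>n. f n = xs n \<or> d (f n) (xs (Suc n)) < d (xs n) (xs (Suc n))" by metis
  have "finite (range f)" using f(1) S(2) by (meson finite_subset image_subsetI)
  then obtain n0 where inf: "infinite {n. f n = f n0}"
    using pigeonhole_infinite[of UNIV f] by auto
  define s where "s = f n0"
  have sM: "s \<in> M" using f(1) SM unfolding s_def by blast
  have "d s (xs (Suc m)) < d (xs m) (xs (Suc m))" for m
  proof -
    have hit: "\<exists>n>k. f n = s" for k
      using inf unfolding s_def infinite_nat_iff_unbounded by auto
    obtain n1 where n1: "n1 > m" "f n1 = s" using hit by blast
    obtain n2 where n2: "n2 > n1" "f n2 = s" using hit by blast
    have "xs n1 \<noteq> xs n2"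
      using pseudopartnering_seq_tail(2)[OF x seq ne n2(1)] nearest_pos[OF D(3)[OF ne, of n1]] D(2)
      by (metis less_irrefl mdist_zero)
    then obtain n where n: "n > m" "d s (xs (Suc n)) < d (xs n) (xs (Suc n))"
      using n1 n2 f(2)[of n1] f(2)[of n2] by (metis less_trans)
    have sn: "d s (xs n) = d (xs n) (xs (Suc n))"
      using isosceles[OF D(2) sM D(2), of "Suc n" n] n(2) commute by metis
    have "d (xs (Suc m)) (xs n) < d (xs m) (xs (Suc m))"
      "d (xs (Suc m)) (xs (Suc n)) < d (xs m) (xs (Suc m))"
      using pseudopartnering_seq_tail(1)[OF x seq ne, of m] n(1) by auto
    then show ?thesis
      using ultrametric[OF sM D(2) D(2), of "Suc m" n] sn
        ultrametric[OF D(2) D(2) D(2), of n "Suc n" "Suc m"] commute[of "xs n" "xs (Suc m)"]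
      by auto
  qed
  then show ?thesis using pseudolimit_if_in_balls[OF x seq sM] by blast
qed

text \<open>
  The point $p$ that is not pseudopartnered is a nearest point of $x$, so it can be the second term.
  If $p$ is unpartnered the sequence stops there; if $p$ has a partner $q$ it goes on to $q$ and
  stops. In the first case $q$ is $p$ itself, so that the same formula describes both sequences.
\<close>

lemma anchored_finite_pseudolimits:
  assumes K: pseudo_anchored and x: "pseudopartnered x"
  shows "\<exists>xs. pseudopartnering_seq x xs \<and> finite {z. pseudolimit xs z}"
proof -
  obtain y where y: "nearest x y" using x unfolding pseudopartnered_iff by blast
  then obtain p where p: "p \<in> M" "d x p \<le> d x y" "\<not> pseudopartnered p"
    using K x unfolding pseudo_anchored_def by blast
  have xM: "x \<in> M" using x by (simp add: pseudopartnered_iff)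
  have xp: "nearest x p" using nearest_if_le[OF y p(1) _ p(2)] p x by blast
  have "\<exists>q\<in>M. pseudopartnering_step p (ereal (d x p)) q (ereal (d p q)) \<and>
      \<not> (\<exists>y. nearest q y \<and> d q y < d p q)"
  proof (cases "unpartnered p")
    case True
    then have no: "\<not> (\<exists>y. nearest p y)" by (simp add: unpartnered_iff)
    show ?thesis
      by (rule bexI[of _ p])
        (use no p xM in \<open>auto simp: pseudopartnering_step_iff zero_ereal_def\<close>)
  next
    case False
    then obtain q where q: "partners p q"
      using p unfolding unpartnered_def partnered_iff by blast
    then have pq: "nearest p q" "nearest q p" by (auto simp: partners_iff_nearest)
    have "d p q < d x p"
      using partners_if_beyond[OF xp pq(1)] x unfolding pseudopartnered_iff partnered_iff by force
    moreover have "\<not> (\<exists>y. nearest q y \<and> d q y < d p q)"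
      using nearest_dist_eq[OF pq(2)] commute[of p q] by auto
    moreover have "q \<in> M" using pq by (simp add: nearest_def)
    ultimately show ?thesis
      using p pq by (intro bexI[of _ q]) (auto simp: pseudopartnering_step_iff)
  qed
  then obtain q where q: "q \<in> M" "pseudopartnering_step p (ereal (d x p)) q (ereal (d p q))"
    "\<not> (\<exists>y. nearest q y \<and> d q y < d p q)" by blast
  define xs where "xs n = (if n = 0 then x else if n = 1 then p else q)" for n :: nat
  define ds where "ds n = (if n = 0 then \<infinity> else if n = 1 then ereal (d x p)
    else if n = 2 then ereal (d p q) else 0)" for n :: nat
  have "pseudopartnering_step (xs n) (ds n) (xs (Suc n)) (ds (Suc n))" for n
  proof -
    consider "n = 0" | "n = 1" | "n = 2" | "n > 2" by linarith
    then show ?thesis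
    proof cases
      case 1
      then show ?thesis using xM xp by (auto simp: xs_def ds_def pseudopartnering_step_iff)
    next
      case 2
      then show ?thesis using q by (simp add: xs_def ds_def)
    next
      case 3
      then show ?thesis using q by (auto simp: xs_def ds_def pseudopartnering_step_iff)
    next
      case 4
      have "\<not> (\<exists>y. nearest q y \<and> ereal (d q y) < 0)" by (simp add: not_less)
      then show ?thesis using q 4 by (auto simp: xs_def ds_def pseudopartnering_step_iff)
    qed
  qed
  then have "pseudopartnering_seq x xs"
    unfolding pseudopartnering_seq_def by (intro exI[of _ ds]) (auto simp: xs_def ds_def)
  moreover have "{z. pseudolimit xs z} \<subseteq> {q}"
  proof
    fix z assume "z \<in> {z. pseudolimit xs z}"
    then have "z \<in> M" "d z (xs 2) = d (xs 2) (xs (Suc 2))" unfolding pseudolimit_def by blast+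
    then show "z \<in> {q}" using q by (auto simp: xs_def)
  qed
  ultimately show ?thesis using finite_subset by blast
qed

section \<open>Pseudo-completeness\<close>

lemma finite_generator_imp_pseudo_complete:
  assumes "metric_generator S" "finite S"
  shows pseudo_complete
  unfolding pseudo_complete_def
  using finite_generator_pseudolimit[OF assms]
    anchored_finite_pseudolimits[OF finite_generator_imp_anchored[OF assms]] by blast

text \<open>
  Suppose that the closed ball around $x$ has only pseudopartnered points. A sequence from $x$ stays
  in the ball and cannot stop: it would stop at one of two partners. The pseudolimits also lie in
  the ball, and a nearest point of a pseudolimit is a pseudolimit too. Among finitely many pairs of
  a pseudolimit and a nearest point of it, the closest pair would be partners.
\<close>

lemma pseudo_complete_imp_anchored:
  assumes pc: pseudo_complete
  shows pseudo_anchored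
  unfolding pseudo_anchored_def
proof (intro allI impI, rule ccontr)
  fix x y assume px: "pseudopartnered x" and xy: "nearest x y"
    and "\<not> (\<exists>p\<in>M. d x p \<le> d x y \<and> \<not> pseudopartnered p)"
  then have all: "\<And>p. p \<in> M \<Longrightarrow> d x p \<le> d x y \<Longrightarrow> pseudopartnered p" by blast
  have x: "x \<in> M" using xy by (simp add: nearest_def)
  obtain xs where seq: "pseudopartnering_seq x xs" and fin: "finite {z. pseudolimit xs z}"
    using pc px x unfolding pseudo_complete_def by blast
  note D = pseudopartnering_seqD[OF x seq]
  let ?L = "{z. pseudolimit xs z}"
  have start: "xs (Suc 0) \<noteq> xs 0" using D(1) D(4)[OF xy] by simp
  have e0: "d x (xs (Suc 0)) = d x y" using D(3)[OF start] D(1) xy nearest_dist_eq by metis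
  have pseudo: "pseudopartnered (xs n)" for n
  proof (cases "n = 0")
    case True
    then show ?thesis using D(1) px by simp
  next
    case False
    then show ?thesis
      using pseudopartnering_seq_tail(2)[OF x seq start, of n] D(1) e0 all D(2)[of n] by simp
  qed
  have ne: "xs (Suc n) \<noteq> xs n" for n
  proof (induction n)
    case 0
    then show ?case by (fact start)
  next
    case (Suc n)
    obtain w where w: "nearest (xs (Suc n)) w" using pseudo pseudopartnered_iff by blast
    have "\<not> d (xs n) (xs (Suc n)) \<le> d (xs (Suc n)) w"
      using partners_if_beyond[OF D(3)[OF Suc] w] pseudo[of n]
      unfolding pseudopartnered_iff partnered_iff by blast
    then show ?case using D(5)[OF w] by simp
  qed
  have pseudoL: "pseudopartnered z" if "z \<in> ?L" for z
  proof -
    have "z \<in> M" "d z (xs 0) = d (xs 0) (xs (Suc 0))"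
      using that unfolding pseudolimit_def by blast+
    then show ?thesis using all[of z] e0 D(1) commute[of z x] by simp
  qed
  have closed: "w \<in> ?L" if z: "z \<in> ?L" and zw: "nearest z w" for z w
  proof -
    have zM: "z \<in> M" and lim: "\<And>n. d z (xs n) = d (xs n) (xs (Suc n))"
      using z unfolding pseudolimit_def by blast+
    have wM: "w \<in> M" using zw by (simp add: nearest_def)
    have "d w (xs n) = d (xs n) (xs (Suc n))" for n
    proof -
      have "xs (Suc n) \<noteq> z"
        using lim[of "Suc n"] nearest_pos[OF D(3)[OF ne, of "Suc n"]] zM by auto
      then have "d z w \<le> d z (xs (Suc n))" using zw D(2) unfolding nearest_def by blast
      also have "\<dots> < d z (xs n)" using lim D(6)[OF ne] by simp
      finally show ?thesis using isosceles[OF zM wM D(2)] lim by simp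
    qed
    then show ?thesis using wM unfolding pseudolimit_def by blast
  qed
  obtain z0 where z0: "z0 \<in> ?L" using pc px x seq unfolding pseudo_complete_def by blast
  define Q where "Q = {(z, w). z \<in> ?L \<and> w \<in> ?L \<and> nearest z w}"
  have "finite Q"
    unfolding Q_def by (rule finite_subset[of _ "?L \<times> ?L"]) (use fin in auto)
  moreover have "Q \<noteq> {}"
    using z0 pseudoL[OF z0] closed[OF z0] unfolding pseudopartnered_iff Q_def by blast
  ultimately have "\<exists>a\<in>Q. \<not> (\<exists>b\<in>Q. case_prod d b < case_prod d a)"
    using arg_min_if_finite[of Q "case_prod d"] by blast
  then obtain z w where zw: "(z, w) \<in> Q" "\<not> (\<exists>b\<in>Q. case_prod d b < d z w)" by auto
  have L: "z \<in> ?L" "w \<in> ?L" "nearest z w" using zw(1) by (auto simp: Q_def)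
  obtain v where v: "nearest w v" using pseudoL[OF L(2)] unfolding pseudopartnered_iff by blast
  have "(w, v) \<in> Q" using v L(2) closed[OF L(2) v] by (simp add: Q_def)
  then have "d z w \<le> d w v" using zw(2) by force
  then have "partners z w" using partners_if_beyond L(3) v by blast
  then show False using pseudoL[OF L(1)] unfolding pseudopartnered_iff partnered_iff by blast
qed

section \<open>Finite metric bases\<close>

lemma finite_metric_basis_exists:
  assumes "metric_generator T" "finite T"
  shows "\<exists>S. finite S \<and> metric_basis S"
proof -
  obtain S where S: "finite S \<and> metric_generator S"
    "\<And>T. finite T \<and> metric_generator T \<Longrightarrow> card S \<le> card T"
    using ex_has_least_nat[of "\<lambda>S. finite S \<and> metric_generator S" T card] assms by blast
  have "S \<lesssim> U" if "metric_generator U" for U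
  proof (cases "finite U")
    case True
    then show ?thesis using S that by (simp add: lepoll_iff_card_le)
  next
    case False
    then show ?thesis using S(1) by (simp add: finite_lepoll_infinite)
  qed
  then show ?thesis using S(1) unfolding metric_basis_def by blast
qed

lemma partner_class_iff: "z \<in> partner_class x \<longleftrightarrow> partners x z \<or> z = x"
  unfolding partner_class_def partners_def by auto

lemma partners_in_partner_class:
  assumes "u \<in> partner_class x" "v \<in> partner_class x" "u \<noteq> v"
  shows "partners u v"
  using assms partners_sym partners_trans unfolding partner_class_iff by metis

lemma partner_class_in_classes:
  assumes "p \<in> partnered_points"
  shows "partner_class p \<in> partner_classes"
proof -
  have "z \<in> partnered_points" if "partners p z" for z
    using partners_sym[OF that] that
    unfolding partnered_points_def partnered_def partners_def by blast
  then have "partner_class p = partner_rel `` {p}"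
    using assms by (auto simp: partner_class_iff partner_rel_def)
  then show ?thesis unfolding partner_classes_def using assms by (simp add: quotientI)
qed

end

theorem theorem2p36:
  fixes M :: "'a set" and d :: "'a \<Rightarrow> 'a \<Rightarrow> real"
  assumes "Ultrametric_space M d"
    and "\<exists>x\<in>M. \<exists>y\<in>M. x \<noteq> y"
  shows "((\<exists>S. finite S \<and> Metric_space.metric_basis M d S) \<longleftrightarrow>
           Metric_space.pseudo_complete M d \<and>
           finite (Metric_space.partnered_points M d \<union> Metric_space.unpartnered_points M d)) \<and>
         (\<forall>S. finite S \<and> Metric_space.metric_basis M d S \<longrightarrow>
           (\<forall>(n :: nat) x.
              x \<in> {1..n} \<rightarrow> Metric_space.partnered_points M d \<and>
              inj_on (\<lambda>i. Metric_space.partner_class M d (x i)) {1..n} \<and>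
              Metric_space.partner_classes M d =
                (\<lambda>i. Metric_space.partner_class M d (x i)) ` {1..n} \<longrightarrow>
              (\<exists>\<alpha> \<in> (\<Pi>\<^sub>E i\<in>{1..n}. Metric_space.partner_class M d (x i)).
                 S = (\<Union>i\<in>{1..n}. Metric_space.partner_class M d (x i) - {\<alpha> i}) \<union>
                     Metric_space.unpartnered_points M d)))"
proof -
  interpret Ultrametric_space M d by (fact assms(1))
  have unp: "unpartnered_points \<subseteq> S" if "metric_generator S" "finite S" for S
    using finite_generator_contains_unpartnered[OF that] assms(2)
    unfolding unpartnered_points_def by blast
  have fwd: "pseudo_complete \<and> finite (partnered_points \<union> unpartnered_points)"
    if "metric_generator S" "finite S" for S
    using finite_generator_imp_pseudo_complete[OF that] finite_partnered_points[OF that]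
      finite_subset[OF unp[OF that] that(2)] by simp
  have "metric_generator (partnered_points \<union> unpartnered_points)" if pseudo_complete
    by (rule anchored_generator[OF pseudo_complete_imp_anchored[OF that]])
      (auto simp: partnered_points_def unpartnered_points_def partnered_iff partners_def)
  then have equiv: "(\<exists>S. finite S \<and> metric_basis S) \<longleftrightarrow>
      pseudo_complete \<and> finite (partnered_points \<union> unpartnered_points)"
    using fwd finite_metric_basis_exists unfolding metric_basis_def by blast
  have basis_form: "\<exists>\<alpha> \<in> (\<Pi>\<^sub>E i\<in>{1..n}. partner_class (x i)).
      S = (\<Union>i\<in>{1..n}. partner_class (x i) - {\<alpha> i}) \<union> unpartnered_points"
    if fin: "finite S" and basis: "metric_basis S" and x: "x \<in> {1..n} \<rightarrow> partnered_points"
      and classes: "partner_classes = (\<lambda>i. partner_class (x i)) ` {1..n}"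
    for S and n :: nat and x
  proof -
    have gen: "metric_generator S" and least: "\<And>T. metric_generator T \<Longrightarrow> S \<lesssim> T"
      using basis unfolding metric_basis_def by auto
    have "\<exists>a\<in>partner_class (x i). a \<in> S \<longrightarrow> partner_class (x i) \<subseteq> S" for i
      by (cases "partner_class (x i) \<subseteq> S") (auto simp: partner_class_iff)
    then obtain a where a: "\<And>i. a i \<in> partner_class (x i)"
      "\<And>i. a i \<in> S \<Longrightarrow> partner_class (x i) \<subseteq> S" by metis
    \<comment> \<open>\<open>a i\<close> is the point of its class that S misses, or an arbitrary one if S misses none.
      The set T is then contained in S, and it generates, so minimality of S gives equality.\<close>
    define T where
      "T = (\<Union>i\<in>{1..n}. partner_class (x i) - {a i}) \<union> unpartnered_points"
    have "z \<in> S" if "z \<in> partner_class (x i)" "z \<noteq> a i" for z i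
      using generator_meets_partners[OF gen partners_in_partner_class[OF that(1) a(1) that(2)]]
        a(2) that by blast
    then have sub: "T \<subseteq> S" using unp[OF gen fin] unfolding T_def by blast
    have hit: "p \<in> T \<or> q \<in> T" if pq: "partners p q" for p q
    proof -
      have "p \<in> partnered_points"
        using pq unfolding partnered_points_def partnered_iff partners_def by blast
      then obtain i where i: "i \<in> {1..n}" "partner_class p = partner_class (x i)"
        using partner_class_in_classes classes by blast
      then have "p \<in> partner_class (x i)" "q \<in> partner_class (x i)" "p \<noteq> q"
        using pq by (auto simp: partner_class_iff partners_def simp flip: i(2))
      then show ?thesis using i(1) unfolding T_def by blast
    qed
    have "T \<subseteq> M" using sub gen unfolding metric_generator_def by (meson order_trans)
    moreover have "unpartnered_points \<subseteq> T" unfolding T_def by blast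
    ultimately have "metric_generator T"
      using hit by (rule anchored_generator[OF finite_generator_imp_anchored[OF gen fin]])
    then have "card S \<le> card T"
      using least[of T] lepoll_iff_card_le[OF fin finite_subset[OF sub fin]] by blast
    then have "S = T" using sub fin card_seteq by metis
    moreover have "T = (\<Union>i\<in>{1..n}. partner_class (x i) - {restrict a {1..n} i}) \<union> unpartnered_points"
      unfolding T_def by auto
    ultimately show ?thesis using a(1) by (intro bexI[of _ "restrict a {1..n}"]) auto
  qed
  show ?thesis
  proof (intro conjI allI impI)
    show "(\<exists>S. finite S \<and> metric_basis S) \<longleftrightarrow>
        pseudo_complete \<and> finite (partnered_points \<union> unpartnered_points)"
      by (fact equiv)
  next
    fix S and n :: nat and x
    assume "finite S \<and> metric_basis S"
      and "x \<in> {1..n} \<rightarrow> partnered_points \<and> inj_on (\<lambda>i. partner_class (x i)) {1..n} \<and>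
        partner_classes = (\<lambda>i. partner_class (x i)) ` {1..n}"
    then show "\<exists>\<alpha> \<in> (\<Pi>\<^sub>E i\<in>{1..n}. partner_class (x i)).
        S = (\<Union>i\<in>{1..n}. partner_class (x i) - {\<alpha> i}) \<union> unpartnered_points"
      by (elim conjE) (rule basis_form)
  qed
qed

end
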